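(* Let $(\mathbb{R}^n,g)$, $n\geq 3$, be a conformally flat Riemannian manifold, where $g=g_\circ/\varphi^2$ and $g_\circ$ is the standard Euclidean metric. Assume that $\varphi(r)$ and $f(r)$ are smooth radial functions of $r=\|x\|^2$, such that $\varphi$ does not vanish and $f$ is strictly monotone, with $f'\neq 0$ everywhere. Then $(\mathbb{R}^n,g,f,\lambda,\nu)$ is a generalized quasi-Einstein manifold if, and only if, $\lambda$ and $\nu$ are also functions of $r$, which are given by $$\nu=\frac{1}{(f')^2}\left[(n-2)\frac{\varphi''}{\varphi}+f''+2f'\frac{\varphi'}{\varphi}\right],$$ $$\lambda=4\left[(n-1)\varphi'(\varphi-r\varphi')+r\varphi(\varphi''-f'\varphi')\right]+2f'\varphi^2.$$ In this case, the scalar curvature of $g$ is $$S=4(n-1)\left[2r\varphi\varphi''-nr(\varphi')^2+n\varphi\varphi'\right].$$ Moreover, if $\varphi$ is a bounded function then the manifold $(\mathbb{R}^n,g)$ is complete.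
   Context: A generalized quasi-Einstein manifold $(M^n,g,f,\lambda,\nu)$ is a connected Riemannian manifold $(M^n,g)$ of dimension $n\geq 3$ together with smooth functions $f,\lambda,\nu:M\to\mathbb{R}$ such that $Ric+\nabla^2 f-\nu\, df\otimes df=\lambda g$, where $Ric$ is the Ricci tensor of $g$ and $\nabla^2 f$ is the Hessian of $f$ with respect to $g$. Primes denote derivatives with respect to $r=\|x\|^2=\sum_i x_i^2$. *)

theory Defs
  imports "HOL-Analysis.Analysis"
begin

section \<open>Smooth functions\<close>

text \<open>A function of $r = \|x\|^2$ only lives on $[0,\infty)$, so the prime is the derivative within
  the half-line (one-sided at \<open>r = 0\<close>); values at negative arguments are irrelevant.\<close>

definition rderiv :: "(real \<Rightarrow> real) \<Rightarrow> real \<Rightarrow> real"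
  where "rderiv h r = vector_derivative h (at r within {0..})"

definition smooth_radial :: "(real \<Rightarrow> real) \<Rightarrow> bool"
  where "smooth_radial h \<longleftrightarrow> (\<forall>k. (rderiv ^^ k) h differentiable_on {0..})"

definition partial_deriv :: "'n::finite \<Rightarrow> (real^'n \<Rightarrow> real) \<Rightarrow> real^'n \<Rightarrow> real"
  where "partial_deriv i F x = frechet_derivative F (at x) (axis i 1)"

text \<open>$C^\infty$: every iterated partial derivative (including order zero) is differentiable everywhere.\<close>

definition smooth :: "(real^'n::finite \<Rightarrow> real) \<Rightarrow> bool"
  where "smooth F \<longleftrightarrow> (\<forall>is. foldr partial_deriv is F differentiable_on UNIV)"


section \<open>Riemannian metrics on $\mathbb{R}^n$ and their curvature\<close>

text \<open>A metric on $\mathbb{R}^n$ is given by its matrix in the global standard chart; all tensors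
  below are given by their components in that chart.\<close>

definition riemannian_metric :: "(real^'n::finite \<Rightarrow> real^'n^'n) \<Rightarrow> bool"
  where "riemannian_metric g \<longleftrightarrow>
    (\<forall>i j. smooth (\<lambda>x. g x $ i $ j)) \<and>
    (\<forall>x. transpose (g x) = g x) \<and>
    (\<forall>x v. v \<noteq> 0 \<longrightarrow> v \<bullet> (g x *v v) > 0)"

text \<open>\<open>christoffel g k i j\<close> is $\Gamma^k_{ij}$.\<close>

definition christoffel ::
  "(real^'n::finite \<Rightarrow> real^'n^'n) \<Rightarrow> 'n \<Rightarrow> 'n \<Rightarrow> 'n \<Rightarrow> real^'n \<Rightarrow> real"
  where "christoffel g k i j x =
    1 / 2 * (\<Sum>l\<in>UNIV. matrix_inv (g x) $ k $ l *
      (partial_deriv i (\<lambda>y. g y $ j $ l) x + partial_deriv j (\<lambda>y. g y $ i $ l) x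
        - partial_deriv l (\<lambda>y. g y $ i $ j) x))"

text \<open>\<open>riemann g l k i j\<close> is the $l$-th component of $R(\partial_i,\partial_j)\partial_k$, where
  $R(X,Y)Z = \nabla_X\nabla_Y Z - \nabla_Y\nabla_X Z - \nabla_{[X,Y]} Z$.\<close>

definition riemann ::
  "(real^'n::finite \<Rightarrow> real^'n^'n) \<Rightarrow> 'n \<Rightarrow> 'n \<Rightarrow> 'n \<Rightarrow> 'n \<Rightarrow> real^'n \<Rightarrow> real"
  where "riemann g l k i j x =
    partial_deriv i (christoffel g l j k) x - partial_deriv j (christoffel g l i k) x
    + (\<Sum>m\<in>UNIV. christoffel g l i m x * christoffel g m j k x
                 - christoffel g l j m x * christoffel g m i k x)"

text \<open>$\mathrm{Ric}(Y,Z) = \mathrm{tr}(X \mapsto R(X,Y)Z)$, so that round spheres have positive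
  Ricci curvature.\<close>

definition ricci :: "(real^'n::finite \<Rightarrow> real^'n^'n) \<Rightarrow> 'n \<Rightarrow> 'n \<Rightarrow> real^'n \<Rightarrow> real"
  where "ricci g j k x = (\<Sum>i\<in>UNIV. riemann g i k i j x)"

definition scalar_curvature :: "(real^'n::finite \<Rightarrow> real^'n^'n) \<Rightarrow> real^'n \<Rightarrow> real"
  where "scalar_curvature g x =
    (\<Sum>j\<in>UNIV. \<Sum>k\<in>UNIV. matrix_inv (g x) $ j $ k * ricci g j k x)"

definition hessian ::
  "(real^'n::finite \<Rightarrow> real^'n^'n) \<Rightarrow> (real^'n \<Rightarrow> real) \<Rightarrow> 'n \<Rightarrow> 'n \<Rightarrow> real^'n \<Rightarrow> real"
  where "hessian g F i j x =
    partial_deriv i (partial_deriv j F) x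
    - (\<Sum>k\<in>UNIV. christoffel g k i j x * partial_deriv k F x)"

text \<open>The underlying manifold is all of $\mathbb{R}^n$, which is connected.\<close>

definition generalized_quasi_einstein ::
  "(real^'n::finite \<Rightarrow> real^'n^'n) \<Rightarrow> (real^'n \<Rightarrow> real) \<Rightarrow> (real^'n \<Rightarrow> real) \<Rightarrow> (real^'n \<Rightarrow> real) \<Rightarrow> bool"
  where "generalized_quasi_einstein g F lam \<nu> \<longleftrightarrow>
    CARD('n) \<ge> 3 \<and> riemannian_metric g \<and> smooth F \<and> smooth lam \<and> smooth \<nu> \<and>
    (\<forall>x i j. ricci g i j x + hessian g F i j x
        - \<nu> x * (partial_deriv i F x * partial_deriv j F x) = lam x * g x $ i $ j)"


section \<open>Completeness\<close>

text \<open>The speed of a piecewise $C^1$ path in the sense of \<^const>\<open>valid_path\<close> may be unbounded near a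
  break point. Since \<^const>\<open>integral\<close> is \<open>0\<close> for non-integrable functions, paths of infinite length have
  to be excluded, which the use of \<^const>\<open>has_integral\<close> does.\<close>

definition riemannian_dist :: "(real^'n::finite \<Rightarrow> real^'n^'n) \<Rightarrow> real^'n \<Rightarrow> real^'n \<Rightarrow> real"
  where "riemannian_dist g x y =
    Inf {L. \<exists>\<gamma>. valid_path \<gamma> \<and> pathstart \<gamma> = x \<and> pathfinish \<gamma> = y \<and>
      ((\<lambda>t. let v = vector_derivative \<gamma> (at t) in sqrt (v \<bullet> (g (\<gamma> t) *v v)))
        has_integral L) {0..1}}"

definition riemannian_complete :: "(real^'n::finite \<Rightarrow> real^'n^'n) \<Rightarrow> bool"
  where "riemannian_complete g \<longleftrightarrow> Metric_space.mcomplete UNIV (riemannian_dist g)"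


section \<open>Radial conformally flat metrics\<close>

text \<open>\<open>mat 1\<close> is the matrix of the Euclidean metric.\<close>

definition conformal_metric :: "(real \<Rightarrow> real) \<Rightarrow> real^'n::finite \<Rightarrow> real^'n^'n"
  where "conformal_metric \<phi> x = (1 / (\<phi> ((norm x)\<^sup>2))\<^sup>2) *\<^sub>R mat 1"

end

theory Submission
  imports Defs
begin

text \<open>The metric is conformally flat with radial factor, so every tensor in the quasi-Einstein equation is rotationally
symmetric: at \<open>x\<close> its components are combinations of \<open>x\<^sub>i x\<^sub>j\<close> and \<open>\<delta>\<^sub>i\<^sub>j\<close>, with coefficients that depend only on
\<open>r = (norm x)\<^sup>2\<close>. The Christoffel symbols of \<open>g\<close> are linear in the gradient \<open>w\<close> of \<open>log \<bar>\<phi>\<bar>\<close>, which turns the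
curvature into an algebraic expression in \<open>w\<close> and its first derivatives (\<open>ricci_of_conformal_christoffel\<close>). For radial
\<open>\<phi>\<close> and \<open>f\<close> this makes the difference of the two sides of the equation explicit (\<open>quasi_einstein_defect\<close>): its
\<open>x\<^sub>i x\<^sub>j\<close> coefficient vanishes exactly if \<open>\<nu>\<close> has the asserted value, and its \<open>\<delta>\<^sub>i\<^sub>j\<close> coefficient exactly if
\<open>\<lambda>\<close> has. For \<open>x \<noteq> 0\<close> the two tensors are independent, and the remaining value of \<open>\<nu>\<close> at the origin follows by
continuity. For the converse, the formulas have to define smooth functions on the whole space, the origin included;
this holds because they are built from functions in a class closed under partial derivatives
(\<open>radial_expr_smooth\<close>).

The scalar curvature is the trace of the Ricci tensor with respect to \<open>g\<close>.

If \<open>\<bar>\<phi>\<bar> \<le> B\<close>, then the length of every path is at least its Euclidean length divided by \<open>B\<close>. A Cauchy sequence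
for the Riemannian distance is thus a Euclidean Cauchy sequence; it has a Euclidean limit, and near that limit the
metric is also bounded above, so the convergence is Riemannian as well
(\<open>riemannian_complete_if_uniform_lower_bound\<close>).\<close>

section \<open>Smoothness of radial expressions\<close>

lemma rderiv_has_derivative:
  assumes "smooth_radial h" "r \<ge> 0"
  shows "(h has_real_derivative rderiv h r) (at r within {0..})"
proof -
  have "(rderiv ^^ 0) h differentiable_on {0..}"
    using assms unfolding smooth_radial_def by blast
  then have "h differentiable (at r within {0..})"
    using assms by (simp add: differentiable_on_def)
  then show ?thesis
    unfolding rderiv_def has_real_derivative_iff_has_vector_derivative
    by (rule vector_derivative_works[THEN iffD1])
qed

lemma smooth_radial_rderiv: "smooth_radial h \<Longrightarrow> smooth_radial (rderiv h)"
  unfolding smooth_radial_def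
  by (metis comp_apply funpow_Suc_right)

lemma partial_derivI: "(F has_derivative D) (at x) \<Longrightarrow> partial_deriv i F x = D (axis i 1)"
  by (simp add: partial_deriv_def frechet_derivative_at[symmetric])

text \<open>The map \<open>x \<mapsto> (norm x)\<^sup>2\<close> takes its values in the half-line, so the chain rule within \<open>{0..}\<close> applies at
every point. This is what makes the one-sided derivative at \<open>0\<close> harmless at the origin.\<close>

lemma radial_has_derivative:
  fixes x :: "real^'n"
  assumes "smooth_radial h"
  shows "((\<lambda>y. h ((norm y)\<^sup>2)) has_derivative (\<lambda>v. rderiv h ((norm x)\<^sup>2) * (2 * (x \<bullet> v)))) (at x)"
proof -
  have "((\<lambda>y::real^'n. (norm y)\<^sup>2) has_derivative (\<lambda>v. 2 * (x \<bullet> v))) (at x)"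
    unfolding power2_norm_eq_inner
    by (auto intro!: derivative_eq_intros simp: inner_commute)
  moreover have "(h has_derivative (*) (rderiv h ((norm x)\<^sup>2))) (at ((norm x)\<^sup>2) within {0..})"
    using rderiv_has_derivative[OF assms, of "(norm x)\<^sup>2"] unfolding has_field_derivative_def by simp
  then have "(h has_derivative (*) (rderiv h ((norm x)\<^sup>2)))
      (at ((norm x)\<^sup>2) within (\<lambda>y::real^'n. (norm y)\<^sup>2) ` UNIV)"
    by (rule has_derivative_subset) auto
  ultimately show ?thesis
    using has_derivative_in_compose by fastforce
qed

text \<open>Smoothness asks for all iterated partial derivatives, so it is enough to exhibit a class of differentiable
functions that contains the functions of interest and is closed under partial derivatives. Differentiating
\<open>h ((norm x)\<^sup>2)\<close> produces coordinates and \<^const>\<open>rderiv\<close>, and the formulas for \<open>\<nu>\<close> and \<open>\<lambda>\<close> contain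
quotients; the class below is the closure under these operations.\<close>

inductive radial_expr :: "(real^'n::finite \<Rightarrow> real) \<Rightarrow> bool" where
  const: "radial_expr (\<lambda>x. c)"
| coord: "radial_expr (\<lambda>x. x $ i)"
| radial: "smooth_radial h \<Longrightarrow> radial_expr (\<lambda>x. h ((norm x)\<^sup>2))"
| add: "radial_expr u \<Longrightarrow> radial_expr v \<Longrightarrow> radial_expr (\<lambda>x. u x + v x)"
| mult: "radial_expr u \<Longrightarrow> radial_expr v \<Longrightarrow> radial_expr (\<lambda>x. u x * v x)"
| inverse: "radial_expr u \<Longrightarrow> (\<And>x. u x \<noteq> 0) \<Longrightarrow> radial_expr (\<lambda>x. inverse (u x))"

text \<open>Each derivative rule yields an expression of the class again. Existence of the derivative and closure are proved
in one induction, because the product and inverse rules need both for the constituents.\<close>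

lemma radial_expr_has_derivative:
  fixes u :: "real^'n::finite \<Rightarrow> real"
  assumes "radial_expr u"
  shows "\<exists>D. (\<forall>x. (u has_derivative D x) (at x)) \<and> (\<forall>i. radial_expr (\<lambda>x. D x (axis i 1)))"
  using assms
proof induction
  case (const c)
  show ?case
    by (rule exI[of _ "\<lambda>x v. 0"]) (auto intro: radial_expr.const)
next
  case (coord j)
  have "radial_expr (\<lambda>x::real^'n. axis i 1 $ j)" for i :: 'n
    by (rule radial_expr.const)
  moreover have "((\<lambda>x::real^'n. x $ j) has_derivative (\<lambda>v. v $ j)) (at x)" for x
    by (rule bounded_linear_imp_has_derivative[OF bounded_linear_vec_nth])
  ultimately show ?case
    by (intro exI[of _ "\<lambda>x v. v $ j"]) auto
next
  case (radial h)
  have "radial_expr (\<lambda>x::real^'n. rderiv h ((norm x)\<^sup>2) * (2 * x $ i))" for i :: 'n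
    by (intro radial_expr.mult radial_expr.const radial_expr.coord radial_expr.radial
        smooth_radial_rderiv radial)
  then show ?case
    by (intro exI[of _ "\<lambda>x v. rderiv h ((norm x)\<^sup>2) * (2 * (x \<bullet> v))"])
       (simp add: radial_has_derivative[OF radial] inner_axis)
next
  case (add u v)
  then obtain D E where "\<forall>x. (u has_derivative D x) (at x)" "\<forall>i. radial_expr (\<lambda>x. D x (axis i 1))"
    "\<forall>x. (v has_derivative E x) (at x)" "\<forall>i. radial_expr (\<lambda>x. E x (axis i 1))" by blast
  then show ?case
    by (intro exI[of _ "\<lambda>x w. D x w + E x w"]) (auto intro: has_derivative_add radial_expr.add)
next
  case (mult u v)
  then obtain D E where "\<forall>x. (u has_derivative D x) (at x)" "\<forall>i. radial_expr (\<lambda>x. D x (axis i 1))"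
    "\<forall>x. (v has_derivative E x) (at x)" "\<forall>i. radial_expr (\<lambda>x. E x (axis i 1))" by blast
  then show ?case using mult.hyps
    by (intro exI[of _ "\<lambda>x w. u x * E x w + D x w * v x"])
       (auto intro: has_derivative_mult intro!: radial_expr.add radial_expr.mult)
next
  case (inverse u)
  then obtain D where D: "\<forall>x. (u has_derivative D x) (at x)" "\<forall>i. radial_expr (\<lambda>x. D x (axis i 1))"
    by blast
  have "((\<lambda>y. inverse (u y)) has_derivative
      (\<lambda>w. (- 1) * (inverse (u x) * D x w * inverse (u x)))) (at x)" for x
    using Deriv.has_derivative_inverse[where f = u and f' = "D x" and x = x and S = UNIV]
      inverse.hyps(2) D(1) by simp
  moreover have "radial_expr (\<lambda>x. (- 1) * (inverse (u x) * D x (axis i 1) * inverse (u x)))" for i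
    using D(2) inverse.hyps by (intro radial_expr.mult radial_expr.const radial_expr.inverse) auto
  ultimately show ?case
    by (intro exI[of _ "\<lambda>x w. (- 1) * (inverse (u x) * D x w * inverse (u x))"]) auto
qed

lemma radial_expr_partial_deriv:
  assumes "radial_expr u" shows "radial_expr (partial_deriv i u)"
proof -
  obtain D where D: "\<forall>x. (u has_derivative D x) (at x)" "\<forall>i. radial_expr (\<lambda>x. D x (axis i 1))"
    using radial_expr_has_derivative[OF assms] by blast
  then have "partial_deriv i u = (\<lambda>x. D x (axis i 1))"
    by (auto simp: partial_derivI)
  then show ?thesis using D(2) by (simp only:)
qed

lemma radial_expr_smooth:
  assumes "radial_expr u" shows "smooth u"
proof -
  have "radial_expr (foldr partial_deriv is u)" for "is"
    by (induction "is") (auto intro: assms radial_expr_partial_deriv)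
  then have "\<exists>D. (foldr partial_deriv is u has_derivative D) (at x)" for "is" x
    using radial_expr_has_derivative by blast
  then show ?thesis
    unfolding smooth_def differentiable_on_def differentiable_def by simp
qed

lemma smooth_continuous: "smooth F \<Longrightarrow> continuous_on UNIV F"
  unfolding smooth_def by (metis differentiable_imp_continuous_on foldr.simps(1) id_apply)

section \<open>Curvature of a conformally flat metric\<close>

abbreviation kron :: "'n \<Rightarrow> 'n \<Rightarrow> real" where
  "kron i j \<equiv> (if i = j then 1 else 0)"

text \<open>For \<open>g = \<psi>^(- 2) g\<^sub>0\<close> with \<open>g\<^sub>0\<close> Euclidean, these are the Christoffel symbols \<open>\<Gamma>\<^sup>k\<^sub>i\<^sub>j\<close> in terms of
\<open>w = \<nabla> log \<bar>\<psi>\<bar>\<close>. The curvature computation only uses that shape, so \<open>w\<close> is kept abstract in it.\<close>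

definition conformal_christoffel :: "('n \<Rightarrow> real) \<Rightarrow> 'n \<Rightarrow> 'n \<Rightarrow> 'n \<Rightarrow> real" where
  "conformal_christoffel w k i j = w k * kron i j - w i * kron k j - w j * kron k i"

lemma conformal_christoffel_symmetric:
  "conformal_christoffel w k i j = conformal_christoffel w k j i"
  by (simp add: conformal_christoffel_def)

lemma trace_conformal_christoffel:
  fixes w :: "'n::finite \<Rightarrow> real"
  shows "(\<Sum>i\<in>UNIV. conformal_christoffel w i i m) = - real CARD('n) * w m"
  by (simp add: conformal_christoffel_def sum_subtractf sum.delta' if_distrib cong: if_cong)

lemma contract_kron:
  fixes a :: "'n::finite \<Rightarrow> real"
  shows "(\<Sum>m\<in>UNIV. a m * kron m k) = a k"
  by (simp add: sum.delta if_distrib cong: if_cong)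

lemma contract_conformal_christoffel_upper:
  fixes w :: "'n::finite \<Rightarrow> real"
  shows "(\<Sum>m\<in>UNIV. a m * conformal_christoffel w m j k)
     = (\<Sum>m\<in>UNIV. a m * w m) * kron j k - a k * w j - a j * w k"
proof -
  have "a m * conformal_christoffel w m j k
      = (a m * w m) * kron j k - (a m * kron m k) * w j - (a m * kron m j) * w k" for m
    by (auto simp: conformal_christoffel_def right_diff_distrib)
  then show ?thesis
    by (simp only: sum_subtractf sum_distrib_right[symmetric] contract_kron)
qed

lemma contract_conformal_christoffel_lower:
  fixes w :: "'n::finite \<Rightarrow> real"
  shows "(\<Sum>m\<in>UNIV. a m * conformal_christoffel w i j m)
     = a j * w i - a i * w j - (\<Sum>m\<in>UNIV. a m * w m) * kron i j"
proof -
  have "a m * conformal_christoffel w i j m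
      = (a m * kron m j) * w i - (a m * kron m i) * w j - (a m * w m) * kron i j" for m
    by (auto simp: conformal_christoffel_def right_diff_distrib)
  then show ?thesis
    by (simp only: sum_subtractf sum_distrib_right[symmetric] contract_kron)
qed

text \<open>Of the two quadratic terms of the Ricci tensor, the first contains a trace of \<open>\<Gamma>\<close>, which is \<open>- n w\<close>. In the
second, contracting the two symbols over \<open>m\<close> leaves single symbols contracted with \<open>w\<close> or traced, so both reduce
to \<open>w\<^sub>j w\<^sub>k\<close> and \<open>\<bar>w\<bar>\<^sup>2 \<delta>\<^sub>j\<^sub>k\<close>.\<close>

lemma conformal_christoffel_quadratic:
  fixes w :: "'n::finite \<Rightarrow> real"
  shows "(\<Sum>i\<in>UNIV. \<Sum>m\<in>UNIV. conformal_christoffel w i i m * conformal_christoffel w m j k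
           - conformal_christoffel w i j m * conformal_christoffel w m i k)
     = (real CARD('n) - 2) * (w j * w k - (\<Sum>m\<in>UNIV. (w m)\<^sup>2) * kron j k)"
proof -
  let ?G = "conformal_christoffel w" and ?n = "real CARD('n)" and ?q = "\<Sum>m\<in>UNIV. w m * w m"
  have 1: "(\<Sum>i\<in>UNIV. \<Sum>m\<in>UNIV. ?G i i m * ?G m j k) = ?n * (2 * (w j * w k) - ?q * kron j k)"
  proof -
    have "(\<Sum>i\<in>UNIV. \<Sum>m\<in>UNIV. ?G i i m * ?G m j k) = (\<Sum>m\<in>UNIV. (- ?n * w m) * ?G m j k)"
      by (subst sum.swap) (simp only: sum_distrib_right[symmetric] trace_conformal_christoffel)
    also have "\<dots> = - ?n * (\<Sum>m\<in>UNIV. w m * ?G m j k)"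
      by (simp add: sum_distrib_left mult.assoc sum_negf)
    also have "\<dots> = ?n * (2 * (w j * w k) - ?q * kron j k)"
      by (simp add: contract_conformal_christoffel_upper algebra_simps)
    finally show ?thesis .
  qed
  have sq: "(\<Sum>m\<in>UNIV. ?G i j m * w m) = - (?q * kron i j)" for i j
    using contract_conformal_christoffel_lower[of w w i j] by (simp add: mult.commute)
  have "(\<Sum>m\<in>UNIV. ?G i j m * ?G m i k)
      = - ?q * (kron i j * kron i k) - w i * ?G i j k - ?G i i j * w k" for i
    using conformal_christoffel_symmetric[of w i i j]
    by (simp add: contract_conformal_christoffel_upper sq)
  then have "(\<Sum>i\<in>UNIV. \<Sum>m\<in>UNIV. ?G i j m * ?G m i k)
      = - ?q * (\<Sum>i\<in>UNIV. kron i j * kron i k) - (\<Sum>i\<in>UNIV. w i * ?G i j k) - (\<Sum>i\<in>UNIV. ?G i i j) * w k"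
    by (simp only: sum_subtractf sum_distrib_left[symmetric] sum_distrib_right[symmetric])
  also have "(\<Sum>i\<in>UNIV. kron i j * kron i k) = kron j k"
    by (subst contract_kron) auto
  also have "(\<Sum>i\<in>UNIV. w i * ?G i j k) = ?q * kron j k - 2 * (w j * w k)"
    by (simp add: contract_conformal_christoffel_upper)
  also have "(\<Sum>i\<in>UNIV. ?G i i j) = - ?n * w j"
    by (rule trace_conformal_christoffel)
  finally have 2: "(\<Sum>i\<in>UNIV. \<Sum>m\<in>UNIV. ?G i j m * ?G m i k)
      = - ?q * kron j k - (?q * kron j k - 2 * (w j * w k)) - - ?n * w j * w k" .
  show ?thesis
    unfolding sum_subtractf 1 2 power2_eq_square by (simp add: algebra_simps)
qed

text \<open>The classical formula for the Ricci tensor under a conformal change of the flat metric, with \<open>D m\<close> the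
differential of \<open>w m\<close>. The symmetry of \<open>D\<close> says that \<open>w\<close> is curl-free at \<open>x\<close>, as a gradient is; it
merges the three linear terms into \<open>n - 2\<close> copies of one.\<close>

lemma ricci_of_conformal_christoffel:
  fixes g :: "real^'n \<Rightarrow> real^'n^'n"
  assumes \<Gamma>: "\<And>k i j y. christoffel g k i j y = conformal_christoffel (\<lambda>m. w m y) k i j"
    and D: "\<And>m. (w m has_derivative D m) (at x)"
    and sym: "\<And>i j. D i (axis j 1) = D j (axis i 1)"
  shows "ricci g j k x
    = (real CARD('n) - 2) * (D j (axis k 1) + w j x * w k x - (\<Sum>m\<in>UNIV. (w m x)\<^sup>2) * kron j k)
      + (\<Sum>m\<in>UNIV. D m (axis m 1)) * kron j k"
proof -
  have pd: "partial_deriv l (christoffel g k i j) x = conformal_christoffel (\<lambda>m. D m (axis l 1)) k i j"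
    for l k i j
  proof -
    have "(christoffel g k i j has_derivative (\<lambda>v. conformal_christoffel (\<lambda>m. D m v) k i j)) (at x)"
      unfolding \<Gamma>[abs_def] conformal_christoffel_def
      by (intro has_derivative_diff has_derivative_mult_left D)
    then show ?thesis by (rule partial_derivI)
  qed
  have "(\<Sum>i\<in>UNIV. conformal_christoffel (\<lambda>m. D m (axis i 1)) i j k)
      = (\<Sum>m\<in>UNIV. D m (axis m 1)) * kron j k - 2 * D j (axis k 1)"
  proof -
    have "conformal_christoffel (\<lambda>m. D m (axis i 1)) i j k
        = D i (axis i 1) * kron j k - D j (axis i 1) * kron i k - D k (axis i 1) * kron i j" for i
      by (simp add: conformal_christoffel_def)
    then show ?thesis
      by (simp add: sum_subtractf sum_distrib_right[symmetric] contract_kron sym[of k j]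
          del: mult_cancel_left)
  qed
  moreover have "(\<Sum>i\<in>UNIV. conformal_christoffel (\<lambda>m. D m (axis j 1)) i i k)
      = - real CARD('n) * D j (axis k 1)"
    by (simp add: trace_conformal_christoffel sym[of k j])
  ultimately show ?thesis
    unfolding ricci_def riemann_def pd unfolding \<Gamma> sum.distrib sum_subtractf[symmetric]
    unfolding conformal_christoffel_quadratic unfolding sum_subtractf
    by (simp add: algebra_simps)
qed

section \<open>Radial conformal factors\<close>

lemma conformal_metric_nth: "conformal_metric \<phi> x $ i $ j = inverse ((\<phi> ((norm x)\<^sup>2))\<^sup>2) * kron i j"
  unfolding conformal_metric_def mat_def vector_scaleR_component vec_lambda_beta real_scaleR_def
    inverse_eq_divide
  by (rule refl)

lemma matrix_inv_eqI:
  fixes A :: "'a::semiring_1^'n^'m"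
  assumes "A ** B = mat 1" "B ** A = mat 1"
  shows "matrix_inv A = B"
proof -
  have "A ** matrix_inv A = mat 1 \<and> matrix_inv A ** A = mat 1"
    unfolding matrix_inv_def
    by (rule someI[where P = "\<lambda>A'. A ** A' = mat 1 \<and> A' ** A = mat 1"]) (use assms in blast)
  then have "(matrix_inv A ** A) ** B = B" by simp
  then show ?thesis unfolding matrix_mul_assoc[symmetric] assms(1) by simp
qed

lemma matrix_inv_conformal_metric:
  fixes x :: "real^'n::finite"
  assumes "\<phi> ((norm x)\<^sup>2) \<noteq> 0"
  shows "matrix_inv (conformal_metric \<phi> x) $ i $ j = (\<phi> ((norm x)\<^sup>2))\<^sup>2 * kron i j"
proof -
  let ?c = "(\<phi> ((norm x)\<^sup>2))\<^sup>2" and ?I = "mat 1 :: real^'n^'n"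
  have "conformal_metric \<phi> x ** (?c *\<^sub>R ?I) = ?I" "(?c *\<^sub>R ?I) ** conformal_metric \<phi> x = ?I"
    using assms by (simp_all add: conformal_metric_def matrix_scalar_ac scalar_matrix_assoc[symmetric])
  then have "matrix_inv (conformal_metric \<phi> x) = ?c *\<^sub>R ?I"
    by (rule matrix_inv_eqI)
  then show ?thesis by (simp add: mat_def)
qed

lemma riemannian_metric_conformal_metric:
  assumes "smooth_radial \<phi>" "\<forall>r\<ge>0. \<phi> r \<noteq> 0"
  shows "riemannian_metric (conformal_metric \<phi> :: real^'n \<Rightarrow> real^'n^'n::finite)"
proof -
  have "radial_expr (\<lambda>x::real^'n. inverse ((\<phi> ((norm x)\<^sup>2))\<^sup>2) * kron i j)" for i j :: 'n
    unfolding power2_eq_square[of "\<phi> _"]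
    by (intro radial_expr.mult radial_expr.inverse radial_expr.radial[OF assms(1)] radial_expr.const)
       (simp_all add: assms(2))
  then have "\<forall>i j. smooth (\<lambda>x::real^'n. conformal_metric \<phi> x $ i $ j)"
    unfolding conformal_metric_nth by (intro allI radial_expr_smooth)
  moreover have "transpose (conformal_metric \<phi> x) = conformal_metric \<phi> x" for x :: "real^'n"
    by (simp add: conformal_metric_def transpose_scalar transpose_mat)
  moreover have "v \<bullet> (conformal_metric \<phi> x *v v) > 0" if "v \<noteq> 0" for x v :: "real^'n"
    using that assms(2)[rule_format, of "(norm x)\<^sup>2"]
    by (simp add: conformal_metric_def scaleR_matrix_vector_assoc[symmetric])
  ultimately show ?thesis unfolding riemannian_metric_def by blast
qed

text \<open>The \<open>m\<close>-th component of the Euclidean gradient of \<open>log \<bar>\<phi> ((norm x)\<^sup>2)\<bar>\<close>.\<close>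

definition log_gradient :: "(real \<Rightarrow> real) \<Rightarrow> 'n \<Rightarrow> real^'n::finite \<Rightarrow> real" where
  "log_gradient \<phi> m x = 2 * (rderiv \<phi> ((norm x)\<^sup>2) / \<phi> ((norm x)\<^sup>2)) * x $ m"

lemma partial_deriv_radial:
  fixes x :: "real^'n::finite"
  assumes "smooth_radial h"
  shows "partial_deriv i (\<lambda>x. h ((norm x)\<^sup>2)) x = 2 * rderiv h ((norm x)\<^sup>2) * x $ i"
  using partial_derivI[OF radial_has_derivative[OF assms, of x]] by (simp add: inner_axis)

lemma christoffel_conformal_metric:
  fixes x :: "real^'n::finite"
  assumes "smooth_radial \<phi>" "\<forall>r\<ge>0. \<phi> r \<noteq> 0"
  shows "christoffel (conformal_metric \<phi>) k i j x = conformal_christoffel (\<lambda>m. log_gradient \<phi> m x) k i j"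
proof -
  let ?r = "(norm x)\<^sup>2"
  have nz: "\<phi> ?r \<noteq> 0" using assms(2) by simp
  have pd: "partial_deriv i (\<lambda>y. conformal_metric \<phi> y $ j $ l) x
      = - 2 * (log_gradient \<phi> i x / (\<phi> ?r)\<^sup>2) * kron j l" for i j l
  proof -
    have "((\<lambda>y::real^'n. inverse ((\<phi> ((norm y)\<^sup>2))\<^sup>2) * kron j l) has_derivative
       (\<lambda>v. - (inverse ((\<phi> ?r)\<^sup>2) * (2 * \<phi> ?r * (rderiv \<phi> ?r * (2 * (x \<bullet> v))))
              * inverse ((\<phi> ?r)\<^sup>2)) * kron j l)) (at x)"
      using nz by (auto intro!: derivative_eq_intros radial_has_derivative[OF assms(1), of x])
    from partial_derivI[OF this, of i] show ?thesis
      using nz by (simp add: conformal_metric_nth log_gradient_def inner_axis field_simps power2_eq_square)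
  qed
  have "christoffel (conformal_metric \<phi>) k i j x = 1 / 2 * (\<Sum>l\<in>UNIV. (- 2) *
      ((log_gradient \<phi> i x * kron j l + log_gradient \<phi> j x * kron i l
        - log_gradient \<phi> l x * kron i j) * kron l k))"
    unfolding christoffel_def pd matrix_inv_conformal_metric[where \<phi> = \<phi> and x = x, OF nz]
    by (intro arg_cong[of _ _ "(*) (1/2)"] sum.cong) (use nz in \<open>auto simp: field_simps\<close>)
  also have "\<dots> = - (\<Sum>l\<in>UNIV. (log_gradient \<phi> i x * kron j l + log_gradient \<phi> j x * kron i l
      - log_gradient \<phi> l x * kron i j) * kron l k)"
    unfolding sum_distrib_left[symmetric] by simp
  also have "\<dots> = conformal_christoffel (\<lambda>m. log_gradient \<phi> m x) k i j"
    unfolding contract_kron by (simp add: conformal_christoffel_def)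
  finally show ?thesis .
qed

lemma vec_axis_nth: "axis i c $ j = (if i = j then c else 0)"
  by (auto simp: axis_def)

lemma sum_square_nth: "(\<Sum>m\<in>UNIV. (x $ m)\<^sup>2) = (norm x)\<^sup>2" for x :: "real^'n::finite"
  unfolding power2_norm_eq_inner inner_vec_def by (simp add: power2_eq_square)

text \<open>By rotational symmetry, the Ricci tensor is a combination of \<open>x\<^sub>j x\<^sub>k\<close> and \<open>\<delta>\<^sub>j\<^sub>k\<close> with radial coefficients. In
the coefficient of \<open>x\<^sub>j x\<^sub>k\<close>, the squares of \<open>\<phi>'/\<phi>\<close> from differentiating and from multiplying the log-gradient
cancel, so only \<open>\<phi>''/\<phi>\<close> is left.\<close>

lemma ricci_conformal_metric:
  fixes x :: "real^'n::finite"
  assumes "smooth_radial \<phi>" "\<forall>r\<ge>0. \<phi> r \<noteq> 0"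
  defines "r \<equiv> (norm x)\<^sup>2" and "n \<equiv> real CARD('n)"
  shows "ricci (conformal_metric \<phi>) j k x
    = 4 * (n - 2) * (rderiv (rderiv \<phi>) r / \<phi> r) * (x $ j * x $ k)
      + (4 * (n - 1) * (rderiv \<phi> r / \<phi> r)
         + 4 * r * (rderiv (rderiv \<phi>) r / \<phi> r - (n - 1) * (rderiv \<phi> r / \<phi> r)\<^sup>2)) * kron j k"
proof -
  define a where "a = rderiv \<phi> r / \<phi> r"
  define c where "c = rderiv (rderiv \<phi>) r / \<phi> r"
  define D where "D m v = 2 * a * v $ m + 4 * (c - a\<^sup>2) * (x \<bullet> v) * x $ m" for m and v :: "real^'n"
  have nz: "\<phi> r \<noteq> 0" using assms(2) by (simp add: r_def)
  have coord: "((\<lambda>x. x $ m) has_derivative (\<lambda>v. v $ m)) (at x)" for m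
    by (rule bounded_linear_imp_has_derivative[OF bounded_linear_vec_nth])
  have D: "(log_gradient \<phi> m has_derivative D m) (at x)" for m
  proof -
    have "((\<lambda>y::real^'n. 2 * (rderiv \<phi> ((norm y)\<^sup>2) / \<phi> ((norm y)\<^sup>2)) * y $ m) has_derivative
        (\<lambda>v. 2 * (rderiv \<phi> r / \<phi> r) * v $ m
          + 2 * ((rderiv (rderiv \<phi>) r * (2 * (x \<bullet> v)) * \<phi> r
                  - rderiv \<phi> r * (rderiv \<phi> r * (2 * (x \<bullet> v)))) / (\<phi> r * \<phi> r)) * x $ m)) (at x)"
      unfolding r_def
      by (intro has_derivative_mult has_derivative_mult_right has_derivative_divide' coord
          radial_has_derivative[OF assms(1)]
          radial_has_derivative[OF smooth_radial_rderiv[OF assms(1)]])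
         (use nz in \<open>simp add: r_def\<close>)
    then show ?thesis
      unfolding log_gradient_def[abs_def]
      by (rule has_derivative_eq_rhs)
         (use nz in \<open>simp add: fun_eq_iff D_def a_def c_def field_simps power2_eq_square\<close>)
  qed
  have "ricci (conformal_metric \<phi>) j k x
    = (n - 2) * (D j (axis k 1) + log_gradient \<phi> j x * log_gradient \<phi> k x
         - (\<Sum>m\<in>UNIV. (log_gradient \<phi> m x)\<^sup>2) * kron j k) + (\<Sum>m\<in>UNIV. D m (axis m 1)) * kron j k"
    unfolding n_def
    by (rule ricci_of_conformal_christoffel[OF christoffel_conformal_metric D])
       (use assms in \<open>auto simp: D_def inner_axis vec_axis_nth\<close>)
  moreover have "log_gradient \<phi> m x = 2 * a * x $ m" for m
    by (simp add: log_gradient_def a_def r_def)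
  moreover have "(\<Sum>m\<in>UNIV. (2 * a * x $ m)\<^sup>2) = 4 * a\<^sup>2 * r"
    by (simp add: power_mult_distrib sum_distrib_left[symmetric] sum_square_nth r_def)
  moreover have "(\<Sum>m\<in>UNIV. D m (axis m 1)) = 2 * a * n + 4 * (c - a\<^sup>2) * r"
    by (simp add: D_def inner_axis sum.distrib mult.assoc power2_eq_square[of "_ $ _", symmetric]
        sum_distrib_left[symmetric] sum_square_nth r_def n_def)
  moreover have "D j (axis k 1) = 2 * a * kron j k + 4 * (c - a\<^sup>2) * x $ k * x $ j"
    by (simp add: D_def inner_axis vec_axis_nth)
  ultimately show ?thesis
    unfolding a_def[symmetric] c_def[symmetric] by (simp add: algebra_simps power2_eq_square)
qed

text \<open>Raising an index multiplies by \<open>\<phi>\<^sup>2\<close>, so this is \<open>\<phi>\<^sup>2\<close> times the Euclidean trace of the Ricci tensor, in which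
\<open>x\<^sub>j x\<^sub>k\<close> contributes \<open>r\<close> and \<open>\<delta>\<^sub>j\<^sub>k\<close> contributes \<open>n\<close>.\<close>

lemma scalar_curvature_conformal_metric:
  fixes x :: "real^'n::finite"
  assumes "smooth_radial \<phi>" "\<forall>r\<ge>0. \<phi> r \<noteq> 0"
  defines "r \<equiv> (norm x)\<^sup>2" and "n \<equiv> real CARD('n)"
  shows "scalar_curvature (conformal_metric \<phi>) x
    = 4 * (n - 1) * (2 * r * \<phi> r * rderiv (rderiv \<phi>) r - n * r * (rderiv \<phi> r)\<^sup>2 + n * \<phi> r * rderiv \<phi> r)"
proof -
  have nz: "\<phi> r \<noteq> 0" using assms(2) by (simp add: r_def)
  have "scalar_curvature (conformal_metric \<phi>) x
      = (\<Sum>j\<in>UNIV. (\<phi> r)\<^sup>2 * ricci (conformal_metric \<phi>) j j x)"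
  proof -
    have "(\<Sum>k\<in>UNIV. matrix_inv (conformal_metric \<phi> x) $ j $ k * ricci (conformal_metric \<phi>) j k x)
        = (\<Sum>k\<in>UNIV. ((\<phi> r)\<^sup>2 * ricci (conformal_metric \<phi>) j k x) * kron k j)" for j :: 'n
      using nz by (intro sum.cong) (auto simp: matrix_inv_conformal_metric r_def)
    then show ?thesis
      by (simp only: scalar_curvature_def contract_kron)
  qed
  also have "\<dots> = (\<Sum>j\<in>UNIV. 4 * (n - 2) * (rderiv (rderiv \<phi>) r * \<phi> r) * (x $ j)\<^sup>2
      + (4 * (n - 1) * (rderiv \<phi> r * \<phi> r)
         + 4 * r * (rderiv (rderiv \<phi>) r * \<phi> r - (n - 1) * (rderiv \<phi> r)\<^sup>2)))"
    using nz unfolding ricci_conformal_metric[OF assms(1,2)] r_def[symmetric] n_def[symmetric]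
    by (intro sum.cong) (simp_all add: field_simps power2_eq_square)
  also have "\<dots> = 4 * (n - 2) * (rderiv (rderiv \<phi>) r * \<phi> r) * r
      + n * (4 * (n - 1) * (rderiv \<phi> r * \<phi> r)
         + 4 * r * (rderiv (rderiv \<phi>) r * \<phi> r - (n - 1) * (rderiv \<phi> r)\<^sup>2))"
    unfolding sum.distrib sum_distrib_left[symmetric] sum_square_nth r_def[symmetric]
    by (simp add: n_def algebra_simps)
  finally show ?thesis by (simp add: algebra_simps power2_eq_square)
qed

lemma hessian_conformal_metric:
  fixes x :: "real^'n::finite"
  assumes "smooth_radial \<phi>" "\<forall>r\<ge>0. \<phi> r \<noteq> 0" "smooth_radial f"
  defines "r \<equiv> (norm x)\<^sup>2"
  shows "hessian (conformal_metric \<phi>) (\<lambda>x. f ((norm x)\<^sup>2)) i j x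
    = 4 * (rderiv (rderiv f) r + 2 * rderiv f r * (rderiv \<phi> r / \<phi> r)) * (x $ i * x $ j)
      + 2 * rderiv f r * (1 - 2 * r * (rderiv \<phi> r / \<phi> r)) * kron i j"
proof -
  let ?F = "\<lambda>x::real^'n. f ((norm x)\<^sup>2)"
  define a where "a = rderiv \<phi> r / \<phi> r"
  have coord: "((\<lambda>x. x $ m) has_derivative (\<lambda>v. v $ m)) (at x)" for m
    by (rule bounded_linear_imp_has_derivative[OF bounded_linear_vec_nth])
  \<comment> \<open>the differential of the first partial derivative of \<open>f ((norm x)\<^sup>2)\<close> in direction \<open>j\<close>\<close>
  have "((\<lambda>y::real^'n. 2 * rderiv f ((norm y)\<^sup>2) * y $ j) has_derivative
      (\<lambda>v. 2 * rderiv f r * v $ j + 2 * (rderiv (rderiv f) r * (2 * (x \<bullet> v))) * x $ j)) (at x)"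
    unfolding r_def
    by (auto intro!: derivative_eq_intros coord
          radial_has_derivative[OF smooth_radial_rderiv[OF assms(3)], of x])
  from partial_derivI[OF this, of i]
  have snd: "partial_deriv i (partial_deriv j ?F) x
      = 2 * rderiv f r * kron i j + 4 * rderiv (rderiv f) r * (x $ i * x $ j)"
    unfolding partial_deriv_radial[OF assms(3), abs_def] inner_axis by (auto simp: axis_def)
  have "(\<Sum>k\<in>UNIV. christoffel (conformal_metric \<phi>) k i j x * partial_deriv k ?F x)
      = (\<Sum>k\<in>UNIV. (2 * rderiv f r * x $ k) * conformal_christoffel (\<lambda>m. log_gradient \<phi> m x) k i j)"
    by (simp add: christoffel_conformal_metric[OF assms(1,2)] partial_deriv_radial[OF assms(3)] r_def
        mult.commute)
  also have "\<dots> = (\<Sum>m\<in>UNIV. (4 * rderiv f r * a) * (x $ m)\<^sup>2) * kron i j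
      - 8 * rderiv f r * a * (x $ i * x $ j)"
    unfolding contract_conformal_christoffel_upper log_gradient_def r_def[symmetric] a_def[symmetric]
    by (simp add: power2_eq_square mult_ac)
  also have "(\<Sum>m\<in>UNIV. (4 * rderiv f r * a) * (x $ m)\<^sup>2) = 4 * rderiv f r * a * r"
    by (simp only: sum_distrib_left[symmetric] sum_square_nth r_def)
  finally show ?thesis
    unfolding hessian_def snd a_def[symmetric] by (simp add: algebra_simps)
qed

section \<open>The quasi-Einstein equation\<close>

definition radial_nu :: "real \<Rightarrow> (real \<Rightarrow> real) \<Rightarrow> (real \<Rightarrow> real) \<Rightarrow> real \<Rightarrow> real" where
  "radial_nu n \<phi> f r = 1 / (rderiv f r)\<^sup>2 *
     ((n - 2) * (rderiv (rderiv \<phi>) r / \<phi> r) + rderiv (rderiv f) r + 2 * rderiv f r * (rderiv \<phi> r / \<phi> r))"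

definition radial_lambda :: "real \<Rightarrow> (real \<Rightarrow> real) \<Rightarrow> (real \<Rightarrow> real) \<Rightarrow> real \<Rightarrow> real" where
  "radial_lambda n \<phi> f r = 4 * ((n - 1) * rderiv \<phi> r * (\<phi> r - r * rderiv \<phi> r)
     + r * \<phi> r * (rderiv (rderiv \<phi>) r - rderiv f r * rderiv \<phi> r)) + 2 * rderiv f r * (\<phi> r)\<^sup>2"

text \<open>All terms of the equation are combinations of \<open>x\<^sub>i x\<^sub>j\<close> and \<open>\<delta>\<^sub>i\<^sub>j\<close>; the two coefficients measure how far
\<open>\<nu>\<close> and \<open>\<lambda>\<close> are from their asserted values, up to factors that do not vanish.\<close>

lemma quasi_einstein_defect:
  fixes x :: "real^'n::finite"
  assumes "smooth_radial \<phi>" "\<forall>r\<ge>0. \<phi> r \<noteq> 0"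
    and "smooth_radial f" "\<forall>r\<ge>0. rderiv f r \<noteq> 0"
  defines "r \<equiv> (norm x)\<^sup>2" and "n \<equiv> real CARD('n)"
    and "F \<equiv> (\<lambda>x::real^'n. f ((norm x)\<^sup>2))"
  shows "ricci (conformal_metric \<phi>) i j x + hessian (conformal_metric \<phi>) F i j x
      - nu * (partial_deriv i F x * partial_deriv j F x) - lam * conformal_metric \<phi> x $ i $ j
    = 4 * (rderiv f r)\<^sup>2 * (radial_nu n \<phi> f r - nu) * (x $ i * x $ j)
      + (radial_lambda n \<phi> f r - lam) / (\<phi> r)\<^sup>2 * kron i j"
proof -
  have "\<phi> r \<noteq> 0" "rderiv f r \<noteq> 0" using assms(2,4) by (auto simp: r_def)
  then show ?thesis
    unfolding F_def ricci_conformal_metric[OF assms(1,2)] hessian_conformal_metric[OF assms(1-3)]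
      partial_deriv_radial[OF assms(3)] conformal_metric_nth radial_nu_def radial_lambda_def
      r_def[symmetric] n_def[symmetric]
    by (simp add: field_simps power2_eq_square)
qed

lemma radial_expr_diff:
  assumes "radial_expr u" "radial_expr v" shows "radial_expr (\<lambda>x. u x - v x)"
  using radial_expr.add[OF assms(1) radial_expr.mult[OF radial_expr.const[of "- 1"] assms(2)]] by simp

lemma radial_expr_sq_norm: "radial_expr (\<lambda>x::real^'n::finite. (norm x)\<^sup>2)"
proof -
  have "radial_expr (\<lambda>x::real^'n. \<Sum>m\<in>M. x $ m * x $ m)" if "finite M" for M :: "'n set"
    using that by induction (simp_all add: radial_expr.const radial_expr.coord radial_expr.add radial_expr.mult)
  then show ?thesis by (simp add: power2_norm_eq_inner inner_vec_def)
qed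

lemma smooth_radial_nu_lambda:
  assumes "smooth_radial \<phi>" "\<forall>r\<ge>0. \<phi> r \<noteq> 0"
    and "smooth_radial f" "\<forall>r\<ge>0. rderiv f r \<noteq> 0"
  shows "smooth (\<lambda>x::real^'n::finite. radial_nu n \<phi> f ((norm x)\<^sup>2))"
    and "smooth (\<lambda>x::real^'n::finite. radial_lambda n \<phi> f ((norm x)\<^sup>2))"
proof -
  note rules = radial_expr.const radial_expr.add radial_expr.mult radial_expr.inverse radial_expr_diff
    radial_expr_sq_norm radial_expr.radial[OF assms(1)] radial_expr.radial[OF assms(3)]
    radial_expr.radial[OF smooth_radial_rderiv[OF assms(1)]]
    radial_expr.radial[OF smooth_radial_rderiv[OF assms(3)]]
    radial_expr.radial[OF smooth_radial_rderiv[OF smooth_radial_rderiv[OF assms(1)]]]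
    radial_expr.radial[OF smooth_radial_rderiv[OF smooth_radial_rderiv[OF assms(3)]]]
  have "radial_expr (\<lambda>x::real^'n::finite. radial_nu n \<phi> f ((norm x)\<^sup>2))"
    unfolding radial_nu_def power2_eq_square[of "rderiv _ _"] divide_inverse
    by (intro rules) (auto simp: assms)
  then show "smooth (\<lambda>x::real^'n::finite. radial_nu n \<phi> f ((norm x)\<^sup>2))" by (rule radial_expr_smooth)
  have "radial_expr (\<lambda>x::real^'n::finite. radial_lambda n \<phi> f ((norm x)\<^sup>2))"
    unfolding radial_lambda_def power2_eq_square[of "\<phi> _"]
    by (intro rules)
  then show "smooth (\<lambda>x::real^'n::finite. radial_lambda n \<phi> f ((norm x)\<^sup>2))" by (rule radial_expr_smooth)
qed

lemma eq_if_eq_off_0: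
  fixes u v :: "'a::{perfect_space,t2_space,zero} \<Rightarrow> 'b::t2_space"
  assumes "continuous_on UNIV u" "continuous_on UNIV v" "\<And>x. x \<noteq> 0 \<Longrightarrow> u x = v x"
  shows "u = v"
proof -
  have "v \<midarrow>0\<rightarrow> u 0"
  proof (rule Lim_transform_eventually)
    show "u \<midarrow>0\<rightarrow> u 0" using assms(1) by (simp add: continuous_on_eq_continuous_at isCont_def)
    show "\<forall>\<^sub>F x in at 0. u x = v x" using assms(3) by (auto simp: eventually_at_topological)
  qed
  moreover have "v \<midarrow>0\<rightarrow> v 0" using assms(2) by (simp add: continuous_on_eq_continuous_at isCont_def)
  ultimately have "u 0 = v 0" by (rule tendsto_unique[OF at_neq_bot])
  with assms(3) show ?thesis by (metis ext)
qed

text \<open>Away from the origin, the tensors \<open>x\<^sub>i x\<^sub>j\<close> and \<open>\<delta>\<^sub>i\<^sub>j\<close> are linearly independent (this needs at least two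
coordinates), so both coefficients of the defect vanish. At the origin \<open>x\<^sub>i x\<^sub>j = 0\<close> and the equation says nothing
about \<open>\<nu>\<close>; its value there is forced by continuity, since both \<open>\<nu>\<close> and the formula are smooth.\<close>

lemma generalized_quasi_einstein_radial_iff:
  fixes lam \<nu> :: "real^'n::finite \<Rightarrow> real"
  assumes "CARD('n) \<ge> 3"
    and "smooth_radial \<phi>" "\<forall>r\<ge>0. \<phi> r \<noteq> 0"
    and "smooth_radial f" "\<forall>r\<ge>0. rderiv f r \<noteq> 0"
  defines "n \<equiv> real CARD('n)"
  shows "generalized_quasi_einstein (conformal_metric \<phi>) (\<lambda>x. f ((norm x)\<^sup>2)) lam \<nu> \<longleftrightarrow>
    (\<forall>x. \<nu> x = radial_nu n \<phi> f ((norm x)\<^sup>2) \<and> lam x = radial_lambda n \<phi> f ((norm x)\<^sup>2))"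
    (is "?gqe \<longleftrightarrow> ?formulas")
proof
  assume gqe: ?gqe
  have eq: "4 * (rderiv f ((norm x)\<^sup>2))\<^sup>2 * (radial_nu n \<phi> f ((norm x)\<^sup>2) - \<nu> x) * (x $ i * x $ j)
      + (radial_lambda n \<phi> f ((norm x)\<^sup>2) - lam x) / (\<phi> ((norm x)\<^sup>2))\<^sup>2 * kron i j = 0" for x i j
    using gqe quasi_einstein_defect[OF assms(2-5), where x = x and i = i and j = j
        and nu = "\<nu> x" and lam = "lam x"]
    unfolding generalized_quasi_einstein_def n_def by simp
  have off: "\<nu> x = radial_nu n \<phi> f ((norm x)\<^sup>2) \<and> lam x = radial_lambda n \<phi> f ((norm x)\<^sup>2)"
    if "x \<noteq> 0" for x
  proof -
    have nz: "\<phi> ((norm x)\<^sup>2) \<noteq> 0" "rderiv f ((norm x)\<^sup>2) \<noteq> 0" using assms(3,5) by auto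
    obtain i where i: "x $ i \<noteq> 0" using \<open>x \<noteq> 0\<close> by (metis vec_eq_iff zero_index)
    obtain j where "j \<noteq> i"
    proof (rule ccontr)
      assume "\<not> thesis"
      then have "(UNIV :: 'n set) = {i}" using that by auto
      then have "CARD('n) = card {i}" by (rule arg_cong)
      then show False using assms(1) by simp
    qed
    show ?thesis
    proof (cases "x $ j = 0")
      case True
      then have "lam x = radial_lambda n \<phi> f ((norm x)\<^sup>2)" using eq[of x j j] nz by simp
      then show ?thesis using eq[of x i i] nz i by simp
    next
      case False
      then have "\<nu> x = radial_nu n \<phi> f ((norm x)\<^sup>2)" using eq[of x i j] \<open>j \<noteq> i\<close> nz i by simp
      then show ?thesis using eq[of x i i] nz by simp
    qed
  qed
  have "\<nu> = (\<lambda>x. radial_nu n \<phi> f ((norm x)\<^sup>2))"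
    using gqe smooth_radial_nu_lambda(1)[OF assms(2-5)] off
    by (intro eq_if_eq_off_0) (auto intro: smooth_continuous simp: generalized_quasi_einstein_def)
  moreover have "lam = (\<lambda>x. radial_lambda n \<phi> f ((norm x)\<^sup>2))"
    using gqe smooth_radial_nu_lambda(2)[OF assms(2-5)] off
    by (intro eq_if_eq_off_0) (auto intro: smooth_continuous simp: generalized_quasi_einstein_def)
  ultimately show ?formulas by simp
next
  assume ?formulas
  then have \<nu>: "\<nu> = (\<lambda>x. radial_nu n \<phi> f ((norm x)\<^sup>2))" and lam: "lam = (\<lambda>x. radial_lambda n \<phi> f ((norm x)\<^sup>2))"
    by auto
  have "smooth \<nu>" "smooth lam"
    unfolding \<nu> lam using smooth_radial_nu_lambda assms by blast+
  moreover have "smooth (\<lambda>x::real^'n. f ((norm x)\<^sup>2))"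
    by (intro radial_expr_smooth radial_expr.radial assms)
  moreover have "ricci (conformal_metric \<phi>) i j x + hessian (conformal_metric \<phi>) (\<lambda>x. f ((norm x)\<^sup>2)) i j x
      - \<nu> x * (partial_deriv i (\<lambda>x. f ((norm x)\<^sup>2)) x * partial_deriv j (\<lambda>x. f ((norm x)\<^sup>2)) x)
      = lam x * conformal_metric \<phi> x $ i $ j" for x i j
    using quasi_einstein_defect[OF assms(2-5), where x = x and i = i and j = j
        and nu = "\<nu> x" and lam = "lam x"]
    unfolding \<nu> lam n_def by simp
  ultimately show ?gqe
    using assms riemannian_metric_conformal_metric[OF assms(2,3)]
    unfolding generalized_quasi_einstein_def by blast
qed

section \<open>Path length and completeness\<close>

definition speed :: "(real^'n::finite \<Rightarrow> real^'n^'n) \<Rightarrow> (real \<Rightarrow> real^'n) \<Rightarrow> real \<Rightarrow> real" where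
  "speed g \<gamma> t = (let v = vector_derivative \<gamma> (at t) in sqrt (v \<bullet> (g (\<gamma> t) *v v)))"

definition path_lengths :: "(real^'n::finite \<Rightarrow> real^'n^'n) \<Rightarrow> real^'n \<Rightarrow> real^'n \<Rightarrow> real set" where
  "path_lengths g x y = {L. \<exists>\<gamma>. valid_path \<gamma> \<and> pathstart \<gamma> = x \<and> pathfinish \<gamma> = y \<and>
     (speed g \<gamma> has_integral L) {0..1}}"

lemma riemannian_dist_eq_Inf: "riemannian_dist g x y = Inf (path_lengths g x y)"
  by (simp add: riemannian_dist_def path_lengths_def speed_def[abs_def])

lemma speed_affine:
  fixes \<gamma> :: "real \<Rightarrow> real^'n::finite"
  assumes "\<gamma> differentiable at (m * t + c)"
    and "open U" "t \<in> U" "\<And>s. s \<in> U \<Longrightarrow> \<delta> s = \<gamma> (m * s + c)"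
  shows "speed g \<delta> t = \<bar>m\<bar> * speed g \<gamma> (m * t + c)"
proof -
  have "((\<lambda>s. m * s + c) has_vector_derivative m) (at t)"
    by (auto intro!: derivative_eq_intros simp: has_real_derivative_iff_has_vector_derivative[symmetric])
  moreover have "(\<gamma> has_vector_derivative vector_derivative \<gamma> (at (m * t + c))) (at (m * t + c))"
    using assms(1) by (simp add: vector_derivative_works)
  ultimately have "((\<lambda>s. \<gamma> (m * s + c)) has_vector_derivative m *\<^sub>R vector_derivative \<gamma> (at (m * t + c))) (at t)"
    using vector_diff_chain_at[of "\<lambda>s. m * s + c"] by (simp add: o_def)
  then have "(\<delta> has_vector_derivative m *\<^sub>R vector_derivative \<gamma> (at (m * t + c))) (at t)"
    by (rule has_vector_derivative_transform_within_open[OF _ assms(2,3)]) (simp add: assms(4))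
  then have "vector_derivative \<delta> (at t) = m *\<^sub>R vector_derivative \<gamma> (at (m * t + c))"
    by (rule vector_derivative_at)
  then show ?thesis
    using assms(3) assms(4)[of t]
    by (simp add: speed_def Let_def matrix_vector_mult_scaleR mult.assoc[symmetric] real_sqrt_mult)
qed

lemma valid_path_differentiable:
  assumes "valid_path \<gamma>"
  obtains S where "finite S" "\<And>t. t \<in> {0..1} - S \<Longrightarrow> \<gamma> differentiable at t"
  using assms unfolding valid_path_def piecewise_C1_differentiable_on_def C1_differentiable_on_eq
  by auto

text \<open>Invariance of length under affine reparametrization, in the form that covers both the reversed path (\<open>m = - 1\<close>) and
the two halves of a concatenation (\<open>m = 2\<close>). Agreement of \<open>\<delta>\<close> with the reparametrized path is only required in
the open interval, since the derivative of a concatenation at its junction need not be that of either half.\<close>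

lemma speed_has_integral_affine:
  fixes \<gamma> :: "real \<Rightarrow> real^'n::finite"
  assumes "valid_path \<gamma>" and L: "(speed g \<gamma> has_integral L) {0..1}"
    and "m \<noteq> 0" and img: "{a..b} = (\<lambda>t. 1 / m * t + - (1 / m * c)) ` {0..1}"
    and \<delta>: "\<And>t. t \<in> {a<..<b} \<Longrightarrow> \<delta> t = \<gamma> (m * t + c)"
  shows "(speed g \<delta> has_integral L) {a..b}"
proof -
  obtain S where S: "finite S" "\<And>t. t \<in> {0..1} - S \<Longrightarrow> \<gamma> differentiable at t"
    using valid_path_differentiable[OF assms(1)] by blast
  have "((\<lambda>t. speed g \<gamma> (m * t + c)) has_integral (1 / \<bar>m\<bar>) * L) {a..b}"
    using has_integral_affinity[of "speed g \<gamma>" L 0 1 m c] L assms(3) unfolding img by simp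
  from has_integral_mult_right[OF this, of "\<bar>m\<bar>"]
  have "((\<lambda>t. \<bar>m\<bar> * speed g \<gamma> (m * t + c)) has_integral L) {a..b}"
    using assms(3) by simp
  then show ?thesis
  proof (rule has_integral_spike_finite[rotated 2])
    show "finite ({a, b} \<union> (\<lambda>t. m * t + c) -` S)"
      using S(1) assms(3) by (auto intro!: finite_vimageI simp: inj_on_def)
    fix t assume t: "t \<in> {a..b} - ({a, b} \<union> (\<lambda>t. m * t + c) -` S)"
    then obtain s where "s \<in> {0..1}" "t = 1 / m * s + - (1 / m * c)"
      using img by auto
    then have "m * t + c = s" using assms(3) by (simp add: field_simps)
    then have "\<gamma> differentiable at (m * t + c)"
      using t S(2) \<open>s \<in> {0..1}\<close> by auto
    then show "speed g \<delta> t = \<bar>m\<bar> * speed g \<gamma> (m * t + c)"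
      by (rule speed_affine[where U = "{a<..<b}"]) (use t \<delta> in auto)
  qed
qed

lemma path_lengths_reverse: "path_lengths g y x \<subseteq> path_lengths g x y"
proof
  fix L assume "L \<in> path_lengths g y x"
  then obtain \<gamma> where \<gamma>: "valid_path \<gamma>" "pathstart \<gamma> = y" "pathfinish \<gamma> = x"
    "(speed g \<gamma> has_integral L) {0..1}" unfolding path_lengths_def by blast
  have "(speed g (reversepath \<gamma>) has_integral L) {0..1}"
    by (rule speed_has_integral_affine[OF \<gamma>(1,4), where m = "-1" and c = 1])
       (simp_all add: reversepath_def image_affinity_atLeastAtMost[of "-1", simplified])
  then show "L \<in> path_lengths g x y"
    using \<gamma> unfolding path_lengths_def by (auto intro!: exI[of _ "reversepath \<gamma>"])
qed

lemma path_lengths_join: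
  assumes "K \<in> path_lengths g x y" "L \<in> path_lengths g y z"
  shows "K + L \<in> path_lengths g x z"
proof -
  obtain \<gamma> where \<gamma>: "valid_path \<gamma>" "pathstart \<gamma> = x" "pathfinish \<gamma> = y"
    "(speed g \<gamma> has_integral K) {0..1}" using assms(1) unfolding path_lengths_def by blast
  obtain \<delta> where \<delta>: "valid_path \<delta>" "pathstart \<delta> = y" "pathfinish \<delta> = z"
    "(speed g \<delta> has_integral L) {0..1}" using assms(2) unfolding path_lengths_def by blast
  have "(speed g (\<gamma> +++ \<delta>) has_integral K) {0..1/2}"
    by (rule speed_has_integral_affine[OF \<gamma>(1,4), where m = 2 and c = 0])
       (simp_all add: joinpaths_def image_affinity_atLeastAtMost)
  moreover have "(speed g (\<gamma> +++ \<delta>) has_integral L) {1/2..1}"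
    by (rule speed_has_integral_affine[OF \<delta>(1,4), where m = 2 and c = "-1"])
       (use image_affinity_atLeastAtMost[of "1/2" "1/2" 0 "1::real"] in \<open>simp_all add: joinpaths_def\<close>)
  ultimately have "(speed g (\<gamma> +++ \<delta>) has_integral (K + L)) {0..1}"
    by (intro has_integral_combine[where c = "1/2"]) auto
  then show ?thesis
    using \<gamma> \<delta> unfolding path_lengths_def
    by (auto intro!: exI[of _ "\<gamma> +++ \<delta>"] valid_path_join)
qed

text \<open>Where the metric dominates a multiple of the Euclidean one, path length dominates the Euclidean distance of the
end points, which is the norm of the integral of the velocity.\<close>

lemma path_lengths_lower_bound:
  fixes g :: "real^'n::finite \<Rightarrow> real^'n^'n"
  assumes L: "L \<in> path_lengths g x y"
    and lower: "\<And>p v. norm v \<le> B * sqrt (v \<bullet> (g p *v v))"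
  shows "dist x y \<le> B * L"
proof -
  obtain \<gamma> where \<gamma>: "valid_path \<gamma>" "pathstart \<gamma> = x" "pathfinish \<gamma> = y"
    "(speed g \<gamma> has_integral L) {0..1}" using L unfolding path_lengths_def by blast
  obtain S where S: "finite S" "\<And>t. t \<in> {0..1} - S \<Longrightarrow> \<gamma> differentiable at t"
    using valid_path_differentiable[OF \<gamma>(1)] by blast
  have int: "((\<lambda>t. vector_derivative \<gamma> (at t)) has_integral (\<gamma> 1 - \<gamma> 0)) {0..1}"
  proof (rule fundamental_theorem_of_calculus_interior_strong[OF S(1)])
    show "continuous_on {0..1} \<gamma>"
      using valid_path_imp_path[OF \<gamma>(1)] by (simp add: path_def)
  qed (use S(2) in \<open>auto simp: vector_derivative_works[symmetric]\<close>)
  have "norm (integral {0..1} (\<lambda>t. vector_derivative \<gamma> (at t))) \<le> integral {0..1} (\<lambda>t. B * speed g \<gamma> t)"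
  proof (rule integral_norm_bound_integral)
    show "(\<lambda>t. B * speed g \<gamma> t) integrable_on {0..1}"
      using has_integral_mult_right[OF \<gamma>(4), of B] by blast
  qed (use int lower in \<open>auto simp: speed_def Let_def\<close>)
  moreover have "integral {0..1} (\<lambda>t. vector_derivative \<gamma> (at t)) = \<gamma> 1 - \<gamma> 0"
    using int by (rule integral_unique)
  moreover have "integral {0..1} (\<lambda>t. B * speed g \<gamma> t) = B * L"
    by (rule integral_unique[OF has_integral_mult_right[OF \<gamma>(4)]])
  ultimately show ?thesis
    using \<gamma>(2,3) by (auto simp: pathstart_def pathfinish_def dist_norm norm_minus_commute)
qed

lemma speed_linepath_integrable:
  fixes g :: "real^'n::finite \<Rightarrow> real^'n^'n"
  assumes cont: "continuous_on UNIV g"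
  shows "speed g (linepath x y) integrable_on {0..1}"
proof -
  have "continuous_on {0..1} (\<lambda>t. g (linepath x y t))"
    by (rule continuous_on_compose2[OF cont]) auto
  then have "continuous_on {0..1} (speed g (linepath x y))"
    unfolding speed_def[abs_def] Let_def vector_derivative_linepath_at
    unfolding matrix_vector_mult_def
    by (intro continuous_intros)
  then show ?thesis by (rule integrable_continuous_real)
qed

lemma path_lengths_linepath:
  fixes g :: "real^'n::finite \<Rightarrow> real^'n^'n"
  assumes cont: "continuous_on UNIV g"
  shows "integral {0..1} (speed g (linepath x y)) \<in> path_lengths g x y"
  using speed_linepath_integrable[OF cont] unfolding path_lengths_def
  by (auto intro!: exI[of _ "linepath x y"] integrable_integral)

lemma path_lengths_bdd_below:
  fixes g :: "real^'n::finite \<Rightarrow> real^'n^'n"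
  assumes lower: "\<And>p v. norm v \<le> B * sqrt (v \<bullet> (g p *v v))" and "B > 0"
    and "L \<in> path_lengths g x y"
  shows "dist x y / B \<le> L"
  using path_lengths_lower_bound[OF assms(3) lower] \<open>B > 0\<close> by (simp add: field_simps)

lemma riemannian_dist_le:
  fixes g :: "real^'n::finite \<Rightarrow> real^'n^'n"
  assumes lower: "\<And>p v. norm v \<le> B * sqrt (v \<bullet> (g p *v v))" and "B > 0"
    and L: "L \<in> path_lengths g x y"
  shows "riemannian_dist g x y \<le> L"
  unfolding riemannian_dist_eq_Inf
  by (rule cInf_lower[OF L])
     (rule bdd_belowI[OF path_lengths_bdd_below[OF lower \<open>B > 0\<close>]])

lemma continuous_on_matrix_entries:
  fixes g :: "'a::topological_space \<Rightarrow> real^'n^'m"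
  assumes "\<And>i j. continuous_on S (\<lambda>x. g x $ i $ j)"
  shows "continuous_on S g"
  using assms unfolding continuous_on_def by (intro ballI vec_tendstoI) auto

text \<open>Reversal and concatenation of paths give symmetry and the triangle inequality; the lower bound on the metric makes
distances positive.\<close>

lemma riemannian_dist_Metric_space:
  fixes g :: "real^'n::finite \<Rightarrow> real^'n^'n"
  assumes cont: "continuous_on UNIV g"
    and lower: "\<And>p v. norm v \<le> B * sqrt (v \<bullet> (g p *v v))" and "B > 0"
  shows "Metric_space UNIV (riemannian_dist g)" "\<And>x y. dist x y \<le> B * riemannian_dist g x y"
proof -
  have ne: "path_lengths g x y \<noteq> {}" for x y using path_lengths_linepath[OF cont] by blast
  note bound = path_lengths_bdd_below[OF lower \<open>B > 0\<close>]
    and le = riemannian_dist_le[OF lower \<open>B > 0\<close>]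
  have lb: "dist x y / B \<le> riemannian_dist g x y" for x y
    unfolding riemannian_dist_eq_Inf by (intro cInf_greatest ne bound)
  then show "dist x y \<le> B * riemannian_dist g x y" for x y
    using \<open>B > 0\<close> by (simp add: field_simps)
  show "Metric_space UNIV (riemannian_dist g)"
  proof
    show nn: "0 \<le> riemannian_dist g x y" for x y
      using lb[of x y] \<open>B > 0\<close> by (meson divide_nonneg_pos order_trans zero_le_dist)
    show "riemannian_dist g x y = riemannian_dist g y x" for x y
      unfolding riemannian_dist_eq_Inf using path_lengths_reverse by (metis subset_antisym)
    show "riemannian_dist g x y = 0 \<longleftrightarrow> x = y" for x y
    proof
      assume "riemannian_dist g x y = 0"
      then show "x = y" using lb[of x y] \<open>B > 0\<close> by (simp add: divide_le_0_iff)
    next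
      assume "x = y"
      have "integral {0..1} (speed g (linepath x x)) = 0"
        by (simp add: speed_def[abs_def])
      then have "riemannian_dist g x x \<le> 0"
        using le[OF path_lengths_linepath[OF cont, of x x]] by simp
      then show "riemannian_dist g x y = 0" using nn[of x x] \<open>x = y\<close> by simp
    qed
    show "riemannian_dist g x z \<le> riemannian_dist g x y + riemannian_dist g y z" for x y z
    proof -
      have "riemannian_dist g x z - K \<le> L" if "K \<in> path_lengths g x y" "L \<in> path_lengths g y z" for K L
        using le[OF path_lengths_join[OF that]] by simp
      then have "riemannian_dist g x z - K \<le> riemannian_dist g y z" if "K \<in> path_lengths g x y" for K
        unfolding riemannian_dist_eq_Inf[of g y z] using that by (intro cInf_greatest ne) auto
      then have "riemannian_dist g x z - riemannian_dist g y z \<le> riemannian_dist g x y"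
        unfolding riemannian_dist_eq_Inf[of g x y] by (intro cInf_greatest ne) (simp add: algebra_simps)
      then show ?thesis by simp
    qed
  qed
qed

text \<open>The quadratic form is bounded on the compact set of pairs of a point of \<open>C\<close> and a unit vector, and it is homogeneous
in the vector.\<close>

lemma metric_norm_upper_bound:
  fixes g :: "'a::t2_space \<Rightarrow> real^'n::finite^'n"
  assumes "compact C" and cont: "continuous_on C g"
  obtains K where "K \<ge> 0" "\<And>p v. p \<in> C \<Longrightarrow> sqrt (v \<bullet> (g p *v v)) \<le> K * norm v"
proof -
  let ?h = "\<lambda>(p, u). u \<bullet> (g p *v u)"
  have "continuous_on (C \<times> sphere 0 1) (\<lambda>z. g (fst z))"
    by (rule continuous_on_compose2[OF cont]) (auto intro: continuous_intros)
  then have "continuous_on (C \<times> sphere 0 1) ?h"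
    unfolding case_prod_beta matrix_vector_mult_def by (intro continuous_intros)
  then have "compact (?h ` (C \<times> sphere 0 1))"
    by (intro compact_continuous_image compact_Times assms(1)) auto
  then obtain M where M: "M > 0" "\<And>p u. p \<in> C \<Longrightarrow> norm u = 1 \<Longrightarrow> \<bar>u \<bullet> (g p *v u)\<bar> \<le> M"
    by (force dest!: compact_imp_bounded simp: bounded_pos)
  have "sqrt (v \<bullet> (g p *v v)) \<le> sqrt M * norm v" if "p \<in> C" for p and v :: "real^'n"
  proof (cases "v = 0")
    case False
    define u where "u = v /\<^sub>R norm v"
    have v: "v = norm v *\<^sub>R u" "norm u = 1" using False by (simp_all add: u_def)
    have "v \<bullet> (g p *v v) = (norm v)\<^sup>2 * (u \<bullet> (g p *v u))"
      by (subst (1 2) v(1)) (simp add: matrix_vector_mult_scaleR power2_eq_square)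
    also have "\<dots> \<le> (norm v)\<^sup>2 * M"
      using M(2)[OF that v(2)] by (intro mult_left_mono) auto
    finally have "sqrt (v \<bullet> (g p *v v)) \<le> sqrt ((norm v)\<^sup>2 * M)"
      by (rule real_sqrt_le_mono)
    then show ?thesis by (simp add: real_sqrt_mult mult.commute)
  qed simp
  with M(1) that[of "sqrt M"] show ?thesis by simp
qed

text \<open>The straight segment from \<open>\<sigma> n\<close> to \<open>x\<close> stays in a compact ball, where the metric is bounded above.\<close>

lemma riemannian_dist_tendsto_0:
  fixes g :: "real^'n::finite \<Rightarrow> real^'n^'n"
  assumes cont: "continuous_on UNIV g"
    and lower: "\<And>p v. norm v \<le> B * sqrt (v \<bullet> (g p *v v))" and "B > 0"
    and \<sigma>: "\<sigma> \<longlonglongrightarrow> x"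
  shows "(\<lambda>n. riemannian_dist g (\<sigma> n) x) \<longlonglongrightarrow> 0"
proof -
  obtain K where K: "K \<ge> 0" "\<And>p v. p \<in> cball x 1 \<Longrightarrow> sqrt (v \<bullet> (g p *v v)) \<le> K * norm v"
    using metric_norm_upper_bound[of "cball x 1" g] continuous_on_subset[OF cont] by auto
  have le: "riemannian_dist g y x \<le> K * dist y x" if "y \<in> cball x 1" for y
  proof -
    let ?I = "integral {0..1} (speed g (linepath y x))"
    have "linepath y x t \<in> cball x 1" if "t \<in> {0..1}" for t
    proof -
      have "linepath y x t \<in> closed_segment y x" using that linepath_in_path by blast
      also have "\<dots> \<subseteq> cball x 1" using \<open>y \<in> cball x 1\<close> by (intro closed_segment_subset) auto
      finally show ?thesis .
    qed
    then have sp: "speed g (linepath y x) t \<le> K * dist y x" if "t \<in> {0..1}" for t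
      using K(2)[of "linepath y x t" "x - y"] that
      by (simp add: speed_def Let_def dist_norm norm_minus_commute)
    have "?I \<in> path_lengths g y x" by (rule path_lengths_linepath[OF cont])
    then have "riemannian_dist g y x \<le> ?I"
      by (rule riemannian_dist_le[OF lower \<open>B > 0\<close>])
    also have "?I \<le> integral {0..1} (\<lambda>t::real. K * dist y x)"
      using speed_linepath_integrable[OF cont] sp by (intro integral_le) auto
    finally show ?thesis by simp
  qed
  show ?thesis
  proof (rule tendsto_sandwich)
    show "\<forall>\<^sub>F n in sequentially. 0 \<le> riemannian_dist g (\<sigma> n) x"
      using Metric_space.nonneg[OF riemannian_dist_Metric_space(1)[OF cont lower \<open>B > 0\<close>]] by simp
    have "\<forall>\<^sub>F n in sequentially. dist (\<sigma> n) x < 1" using \<sigma> by (rule tendstoD) simp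
    then show "\<forall>\<^sub>F n in sequentially. riemannian_dist g (\<sigma> n) x \<le> K * dist (\<sigma> n) x"
      by eventually_elim (rule le, simp add: dist_commute)
    show "(\<lambda>n. K * dist (\<sigma> n) x) \<longlonglongrightarrow> 0"
      using tendsto_mult_right_zero[OF tendsto_dist_iff[THEN iffD1, OF \<sigma>]] .
  qed simp
qed

text \<open>Because the Riemannian distance dominates the Euclidean one, its Cauchy sequences converge in the Euclidean
sense, and hence also in the Riemannian one.\<close>

lemma riemannian_complete_if_uniform_lower_bound:
  fixes g :: "real^'n::finite \<Rightarrow> real^'n^'n"
  assumes cont: "continuous_on UNIV g"
    and lower: "\<And>p v. norm v \<le> B * sqrt (v \<bullet> (g p *v v))" and "B > 0"
  shows "riemannian_complete g"
proof -
  interpret R: Metric_space UNIV "riemannian_dist g"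
    by (rule riemannian_dist_Metric_space(1)[OF cont lower \<open>B > 0\<close>])
  have "\<exists>x. limitin R.mtopology \<sigma> x sequentially" if cauchy: "R.MCauchy \<sigma>" for \<sigma>
  proof -
    have "Cauchy \<sigma>"
      unfolding Cauchy_def
    proof (intro allI impI)
      fix e :: real assume "e > 0"
      then have "e / B > 0" using \<open>B > 0\<close> by simp
      then obtain N where N: "\<And>m n. m \<ge> N \<Longrightarrow> n \<ge> N \<Longrightarrow> riemannian_dist g (\<sigma> m) (\<sigma> n) < e / B"
        using cauchy unfolding R.MCauchy_def by blast
      have "dist (\<sigma> m) (\<sigma> n) < e" if "m \<ge> N" "n \<ge> N" for m n
        using N[OF that] riemannian_dist_Metric_space(2)[OF cont lower \<open>B > 0\<close>, of "\<sigma> m" "\<sigma> n"] \<open>B > 0\<close>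
        by (simp add: field_simps)
      then show "\<exists>M. \<forall>m\<ge>M. \<forall>n\<ge>M. dist (\<sigma> m) (\<sigma> n) < e" by blast
    qed
    then obtain x where "\<sigma> \<longlonglongrightarrow> x" using Cauchy_convergent convergentD by blast
    then have "(\<lambda>n. riemannian_dist g (\<sigma> n) x) \<longlonglongrightarrow> 0"
      by (rule riemannian_dist_tendsto_0[OF cont lower \<open>B > 0\<close>])
    then have "limitin R.mtopology \<sigma> x sequentially"
      by (simp add: R.limitin_metric_dist_null)
    then show ?thesis ..
  qed
  then show ?thesis unfolding riemannian_complete_def R.mcomplete_def by blast
qed

text \<open>The norm of \<open>g\<close> at \<open>p\<close> is the Euclidean norm divided by \<open>\<bar>\<phi> ((norm p)\<^sup>2)\<bar>\<close>, so an upper bound for \<open>\<phi>\<close> is a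
uniform lower bound for the metric.\<close>

lemma riemannian_complete_conformal_metric:
  assumes "smooth_radial \<phi>" "\<forall>r\<ge>0. \<phi> r \<noteq> 0" "bounded (\<phi> ` {0..})"
  shows "riemannian_complete (conformal_metric \<phi> :: real^'n::finite \<Rightarrow> real^'n^'n)"
proof -
  obtain B where B: "B > 0" "\<And>r. r \<ge> 0 \<Longrightarrow> \<bar>\<phi> r\<bar> \<le> B"
    using assms(3) by (auto simp: bounded_pos)
  show ?thesis
  proof (rule riemannian_complete_if_uniform_lower_bound[OF _ _ B(1)])
    show "continuous_on UNIV (conformal_metric \<phi> :: real^'n \<Rightarrow> real^'n^'n)"
      using riemannian_metric_conformal_metric[OF assms(1,2)] unfolding riemannian_metric_def
      by (intro continuous_on_matrix_entries smooth_continuous) blast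
    show "norm v \<le> B * sqrt (v \<bullet> (conformal_metric \<phi> p *v v))" for p v :: "real^'n"
    proof -
      have nz: "\<bar>\<phi> ((norm p)\<^sup>2)\<bar> > 0" using assms(2) by simp
      have "sqrt (v \<bullet> (conformal_metric \<phi> p *v v)) = norm v / \<bar>\<phi> ((norm p)\<^sup>2)\<bar>"
        by (simp add: conformal_metric_def scaleR_matrix_vector_assoc[symmetric] real_sqrt_divide
            norm_eq_sqrt_inner[symmetric])
      moreover have "norm v * \<bar>\<phi> ((norm p)\<^sup>2)\<bar> \<le> norm v * B"
        using B(2) by (intro mult_left_mono) auto
      then have "norm v \<le> B * (norm v / \<bar>\<phi> ((norm p)\<^sup>2)\<bar>)"
        using nz by (simp add: field_simps)
      ultimately show ?thesis by simp
    qed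
  qed
qed

section \<open>Characterization, scalar curvature and completeness\<close>

theorem theorem1p4:
  fixes \<phi> f :: "real \<Rightarrow> real"
    and lam \<nu> :: "real^'n::finite \<Rightarrow> real"
  assumes "CARD('n) \<ge> 3"
    and "smooth_radial \<phi>"
    and "smooth_radial f"
    and "\<forall>r\<ge>0. \<phi> r \<noteq> 0"
    and "strict_mono_on {0..} f \<or> strict_antimono_on {0..} f"
    and "\<forall>r\<ge>0. rderiv f r \<noteq> 0"
  shows "(generalized_quasi_einstein (conformal_metric \<phi>) (\<lambda>x. f ((norm x)\<^sup>2)) lam \<nu> \<longleftrightarrow>
           (\<forall>x r. r = (norm x)\<^sup>2 \<longrightarrow>
             \<nu> x = 1 / (rderiv f r)\<^sup>2 *
               ((real CARD('n) - 2) * (rderiv (rderiv \<phi>) r / \<phi> r) + rderiv (rderiv f) r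
                 + 2 * rderiv f r * (rderiv \<phi> r / \<phi> r)) \<and>
             lam x = 4 * ((real CARD('n) - 1) * rderiv \<phi> r * (\<phi> r - r * rderiv \<phi> r)
                 + r * \<phi> r * (rderiv (rderiv \<phi>) r - rderiv f r * rderiv \<phi> r))
               + 2 * rderiv f r * (\<phi> r)\<^sup>2)) \<and>
         (generalized_quasi_einstein (conformal_metric \<phi>) (\<lambda>x. f ((norm x)\<^sup>2)) lam \<nu> \<longrightarrow>
           (\<forall>x r. r = (norm x)\<^sup>2 \<longrightarrow>
             scalar_curvature (conformal_metric \<phi> :: real^'n \<Rightarrow> real^'n^'n) x =
               4 * (real CARD('n) - 1) *
                 (2 * r * \<phi> r * rderiv (rderiv \<phi>) r - real CARD('n) * r * (rderiv \<phi> r)\<^sup>2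
                   + real CARD('n) * \<phi> r * rderiv \<phi> r))) \<and>
         (bounded (\<phi> ` {0..}) \<longrightarrow>
           riemannian_complete (conformal_metric \<phi> :: real^'n \<Rightarrow> real^'n^'n))"
  using generalized_quasi_einstein_radial_iff[OF assms(1,2,4,3,6), of lam \<nu>]
    scalar_curvature_conformal_metric[OF assms(2,4), where 'n = 'n]
    riemannian_complete_conformal_metric[OF assms(2,4), where 'n = 'n]
  unfolding radial_nu_def radial_lambda_def by simp

end
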